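(* Let $A$ be a Banach algebra. If $A^{***}A^{**}\subseteq A^{*}$ and $A^{**}$ is weakly amenable, then $A$ is weakly amenable.
   Context: $A^{**}$ is a Banach algebra under the first Arens product: $\langle a'a,b\rangle=\langle a',ab\rangle$, $\langle a''a',a\rangle=\langle a'',a'a\rangle$, $\langle a''b'',a'\rangle=\langle a'',b''a'\rangle$ for $a,b\in A$, $a'\in A^*$, $a'',b''\in A^{**}$. For $a'''\in A^{***}$ and $a''\in A^{**}$, $a'''a''\in A^{***}$ is defined by $\langle a'''a'',b''\rangle=\langle a''',a''b''\rangle$ for $b''\in A^{**}$; $A^{***}A^{**}$ is the set of such products, and $A^*$ is regarded as a subspace of $A^{***}$ via the canonical embedding. A Banach algebra $B$ is weakly amenable if every bounded derivation $D:B\to B^*$ (bounded linear, $D(xy)=xD(y)+D(x)y$) is inner, i.e. of the form $D(a)=af-fa$ for some $f\in B^*$, where $B^*$ is the dual $B$-bimodule: $\langle fa,b\rangle=\langle f,ab\rangle$, $\langle af,b\rangle=\langle f,ba\rangle$. *)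

theory Defs
  imports "HOL-Analysis.Analysis"
begin

text \<open>
  Banach algebras are taken over the complex numbers.  They need not be unital or commutative, and
  the norm is submultiplicative.  HOL-Analysis only provides the real classes, so complex scalar
  multiplication is added on top of them, compatibly with the real one.
\<close>

class complex_normed_vector = real_normed_vector +
  fixes scaleC :: "complex \<Rightarrow> 'a \<Rightarrow> 'a"  (infixr \<open>*\<^sub>C\<close> 75)
  assumes scaleC_add_right: "c *\<^sub>C (x + y) = c *\<^sub>C x + c *\<^sub>C y"
    and scaleC_add_left: "(c + d) *\<^sub>C x = c *\<^sub>C x + d *\<^sub>C x"
    and scaleC_scaleC: "c *\<^sub>C d *\<^sub>C x = (c * d) *\<^sub>C x"
    and scaleC_of_real: "complex_of_real r *\<^sub>C x = r *\<^sub>R x"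
    and norm_scaleC: "norm (c *\<^sub>C x) = cmod c * norm x"

class complex_banach_algebra = complex_normed_vector + real_normed_algebra + banach +
  assumes scaleC_mult_left: "(c *\<^sub>C x) * y = c *\<^sub>C (x * y)"
    and scaleC_mult_right: "x * (c *\<^sub>C y) = c *\<^sub>C (x * y)"

instantiation complex :: complex_banach_algebra
begin

definition scaleC_complex :: "complex \<Rightarrow> complex \<Rightarrow> complex"
  where "scaleC_complex c x = c * x"

instance
  by standard (auto simp: scaleC_complex_def algebra_simps norm_mult scaleR_conv_of_real)

end

definition bounded_clinear ::
    "('a::complex_normed_vector \<Rightarrow> 'b::complex_normed_vector) \<Rightarrow> bool"
  where "bounded_clinear f \<longleftrightarrow> bounded_linear f \<and> (\<forall>c x. f (c *\<^sub>C x) = c *\<^sub>C f x)"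

lemma bounded_clinearI:
  assumes "\<And>x y. f (x + y) = f x + f y"
    and "\<And>c x. f (c *\<^sub>C x) = c *\<^sub>C f x"
    and "\<And>x. norm (f x) \<le> K * norm x"
  shows "bounded_clinear f"
  unfolding bounded_clinear_def
proof (intro conjI allI)
  show "bounded_linear f"
  proof (rule bounded_linear_intro)
    show "f (r *\<^sub>R x) = r *\<^sub>R f x" for r x
      using assms(2)[of "complex_of_real r" x] by (simp add: scaleC_of_real)
    show "norm (f x) \<le> norm x * K" for x
      using assms(3)[of x] by (simp add: mult.commute)
  qed (rule assms(1))
qed (rule assms(2))

lemma bounded_clinear_bounded_linear: "bounded_clinear f \<Longrightarrow> bounded_linear f"
  by (simp add: bounded_clinear_def)

lemma bounded_clinear_scaleC: "bounded_clinear f \<Longrightarrow> f (c *\<^sub>C x) = c *\<^sub>C f x"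
  by (simp add: bounded_clinear_def)


section \<open>The dual of a complex normed space\<close>

typedef (overloaded) 'a cdual = "{f :: 'a::complex_normed_vector \<Rightarrow> complex. bounded_clinear f}"
  morphisms dual_apply Abs_cdual
  by (rule exI[of _ "\<lambda>_. 0"]) (auto intro: bounded_clinearI[where K = 0] simp: scaleC_complex_def)

setup_lifting type_definition_cdual

lemma cdual_eqI: "(\<And>x. dual_apply f x = dual_apply g x) \<Longrightarrow> f = g"
  by transfer auto

lemma bounded_clinear_dual_apply: "bounded_clinear (dual_apply f)"
  by transfer

lemma bounded_linear_dual_apply: "bounded_linear (dual_apply f)"
  by (rule bounded_clinear_bounded_linear[OF bounded_clinear_dual_apply])

lemma dual_apply_add: "dual_apply f (x + y) = dual_apply f x + dual_apply f y"
  by (rule linear_simps[OF bounded_linear_dual_apply])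

lemma dual_apply_scaleC: "dual_apply f (c *\<^sub>C x) = c * dual_apply f x"
  using bounded_clinear_scaleC[OF bounded_clinear_dual_apply[of f]] by (simp add: scaleC_complex_def)

instantiation cdual :: (complex_normed_vector) complex_normed_vector
begin

lift_definition zero_cdual :: "'a cdual" is "\<lambda>_. 0"
  by (rule bounded_clinearI[where K = 0]) (auto simp: scaleC_complex_def)

lift_definition uminus_cdual :: "'a cdual \<Rightarrow> 'a cdual" is "\<lambda>f x. - f x"
  by (auto simp: bounded_clinear_def scaleC_complex_def intro: bounded_linear_minus)

lift_definition plus_cdual :: "'a cdual \<Rightarrow> 'a cdual \<Rightarrow> 'a cdual" is "\<lambda>f g x. f x + g x"
  by (auto simp: bounded_clinear_def scaleC_complex_def algebra_simps intro: bounded_linear_add)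

lift_definition minus_cdual :: "'a cdual \<Rightarrow> 'a cdual \<Rightarrow> 'a cdual" is "\<lambda>f g x. f x - g x"
  by (auto simp: bounded_clinear_def scaleC_complex_def algebra_simps intro: bounded_linear_sub)

lift_definition scaleR_cdual :: "real \<Rightarrow> 'a cdual \<Rightarrow> 'a cdual" is "\<lambda>r f x. r *\<^sub>R f x"
  by (auto simp: bounded_clinear_def scaleC_complex_def intro: bounded_linear_const_scaleR)

lift_definition scaleC_cdual :: "complex \<Rightarrow> 'a cdual \<Rightarrow> 'a cdual" is "\<lambda>c f x. c * f x"
  by (auto simp: bounded_clinear_def scaleC_complex_def intro: bounded_linear_const_mult)

lift_definition norm_cdual :: "'a cdual \<Rightarrow> real" is onorm .

definition dist_cdual :: "'a cdual \<Rightarrow> 'a cdual \<Rightarrow> real"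
  where "dist_cdual f g = norm (f - g)"

definition sgn_cdual :: "'a cdual \<Rightarrow> 'a cdual"
  where "sgn_cdual f = inverse (norm f) *\<^sub>R f"

definition uniformity_cdual :: "('a cdual \<times> 'a cdual) filter"
  where "uniformity_cdual = (INF e\<in>{0<..}. principal {(f, g). dist f g < e})"

definition open_cdual :: "'a cdual set \<Rightarrow> bool"
  where "open_cdual U \<longleftrightarrow> (\<forall>f\<in>U. eventually (\<lambda>(f', g). f' = f \<longrightarrow> g \<in> U) uniformity)"

instance
proof
  fix f g h :: "'a cdual" and r s :: real and c d :: complex
  show "f + g + h = f + (g + h)" "f + g = g + f" "0 + f = f" "- f + f = 0" "f - g = f + - g"
    by (transfer; simp add: algebra_simps)+
  show "r *\<^sub>R (f + g) = r *\<^sub>R f + r *\<^sub>R g" "(r + s) *\<^sub>R f = r *\<^sub>R f + s *\<^sub>R f"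
    "r *\<^sub>R s *\<^sub>R f = (r * s) *\<^sub>R f" "1 *\<^sub>R f = f"
    by (transfer; simp add: algebra_simps)+
  show "c *\<^sub>C (f + g) = c *\<^sub>C f + c *\<^sub>C g" "(c + d) *\<^sub>C f = c *\<^sub>C f + d *\<^sub>C f"
    "c *\<^sub>C d *\<^sub>C f = (c * d) *\<^sub>C f"
    by (transfer; simp add: algebra_simps)+
  show "complex_of_real r *\<^sub>C f = r *\<^sub>R f"
    by transfer (simp add: scaleR_conv_of_real)
  show "norm (r *\<^sub>R f) = \<bar>r\<bar> * norm f"
    by transfer (auto intro: onorm_scaleR bounded_clinear_bounded_linear)
  show "norm (f + g) \<le> norm f + norm g"
    by transfer (auto intro: onorm_triangle bounded_clinear_bounded_linear)
  show "(norm f = 0) = (f = 0)"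
    by transfer (auto simp: onorm_eq_0 bounded_clinear_bounded_linear fun_eq_iff)
  show "norm (c *\<^sub>C f) = cmod c * norm f"
  proof transfer
    fix c and f :: "'a \<Rightarrow> complex"
    assume "bounded_clinear f"
    then have "onorm (\<lambda>x. cmod c *\<^sub>R f x) = \<bar>cmod c\<bar> * onorm f"
      by (intro onorm_scaleR bounded_clinear_bounded_linear)
    then show "onorm (\<lambda>x. c * f x) = cmod c * onorm f"
      by (simp add: onorm_def norm_mult)
  qed
qed (rule dist_cdual_def sgn_cdual_def uniformity_cdual_def open_cdual_def)+

end

lemma norm_dual_apply: "cmod (dual_apply f x) \<le> norm f * norm x"
  by transfer (rule onorm[OF bounded_clinear_bounded_linear])

lemma norm_cdual_le:
  "0 \<le> K \<Longrightarrow> (\<And>x. cmod (dual_apply f x) \<le> K * norm x) \<Longrightarrow> norm f \<le> K"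
  by transfer (rule onorm_bound)

lemmas dual_apply_simps [simp] =
  plus_cdual.rep_eq minus_cdual.rep_eq uminus_cdual.rep_eq zero_cdual.rep_eq
  scaleR_cdual.rep_eq scaleC_cdual.rep_eq

instance cdual :: (complex_normed_vector) banach
proof
  fix X :: "nat \<Rightarrow> 'a cdual"
  assume X: "Cauchy X"
  define Y where "Y n = Blinfun (dual_apply (X n))" for n
  have Y: "blinfun_apply (Y n) = dual_apply (X n)" for n
    unfolding Y_def by (rule bounded_linear_Blinfun_apply[OF bounded_linear_dual_apply])
  have dist_Y: "dist (Y m) (Y n) = dist (X m) (X n)" for m n
    by (simp add: dist_norm norm_blinfun.rep_eq norm_cdual.rep_eq blinfun.diff_left Y
        minus_blinfun.rep_eq)
  have "Cauchy Y"
    using X by (simp add: Cauchy_def dist_Y)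
  then obtain L where L: "Y \<longlonglongrightarrow> L"
    using Cauchy_convergent_iff convergent_def by blast
  have lim: "(\<lambda>n. dual_apply (X n) x) \<longlonglongrightarrow> blinfun_apply L x" for x
    using blinfun.tendsto[OF L, of "\<lambda>_. x" x] by (simp add: Y)
  have "bounded_clinear (blinfun_apply L)"
    unfolding bounded_clinear_def
  proof (intro conjI allI)
    fix c x
    have "(\<lambda>n. dual_apply (X n) (c *\<^sub>C x)) \<longlonglongrightarrow> c * blinfun_apply L x"
      unfolding dual_apply_scaleC by (intro tendsto_intros lim)
    with lim show "blinfun_apply L (c *\<^sub>C x) = c *\<^sub>C blinfun_apply L x"
      unfolding scaleC_complex_def by (rule LIMSEQ_unique)
  qed (rule blinfun.bounded_linear_right)
  then have *: "dual_apply (Abs_cdual (blinfun_apply L)) = blinfun_apply L"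
    by (simp add: Abs_cdual_inverse)
  have "dist (X n) (Abs_cdual (blinfun_apply L)) = dist (Y n) L" for n
    by (simp add: dist_norm norm_blinfun.rep_eq norm_cdual.rep_eq blinfun.diff_left Y *
        minus_blinfun.rep_eq)
  with L have "X \<longlonglongrightarrow> Abs_cdual (blinfun_apply L)"
    unfolding tendsto_iff by simp
  then show "convergent X"
    by (auto simp: convergent_def)
qed


section \<open>The dual bimodule and weak amenability\<close>

lemma bounded_clinear_dual_rmult:
  fixes f :: "'a::complex_banach_algebra \<Rightarrow> complex"
  assumes "bounded_clinear f"
  shows "bounded_clinear (\<lambda>b. f (a * b))"
  using assms bounded_linear_compose[OF _ bounded_linear_mult_right, of f a]
  by (auto simp: bounded_clinear_def scaleC_mult_right)

lemma bounded_clinear_dual_lmult: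
  fixes f :: "'a::complex_banach_algebra \<Rightarrow> complex"
  assumes "bounded_clinear f"
  shows "bounded_clinear (\<lambda>b. f (b * a))"
  using assms bounded_linear_compose[OF _ bounded_linear_mult_left, of f a]
  by (auto simp: bounded_clinear_def scaleC_mult_left)

text \<open>The right action \<open>f a\<close> and the left action \<open>a f\<close> of an algebra on its dual.\<close>

lift_definition dual_rmult ::
  "'a::complex_banach_algebra cdual \<Rightarrow> 'a \<Rightarrow> 'a cdual"  (infixl \<open>\<triangleleft>\<close> 70)
  is "\<lambda>f a b. f (a * b)"
  by (rule bounded_clinear_dual_rmult)

lift_definition dual_lmult ::
  "'a::complex_banach_algebra \<Rightarrow> 'a cdual \<Rightarrow> 'a cdual"  (infixr \<open>\<triangleright>\<close> 70)
  is "\<lambda>a f b. f (b * a)"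
  by (rule bounded_clinear_dual_lmult)

definition bounded_derivation :: "('a::complex_banach_algebra \<Rightarrow> 'a cdual) \<Rightarrow> bool"
  where "bounded_derivation D \<longleftrightarrow>
    bounded_clinear D \<and> (\<forall>x y. D (x * y) = x \<triangleright> D y + D x \<triangleleft> y)"

definition inner_derivation :: "('a::complex_banach_algebra \<Rightarrow> 'a cdual) \<Rightarrow> bool"
  where "inner_derivation D \<longleftrightarrow> (\<exists>f. \<forall>a. D a = a \<triangleright> f - f \<triangleleft> a)"

definition weakly_amenable :: "'a::complex_banach_algebra itself \<Rightarrow> bool"
  where "weakly_amenable _ \<longleftrightarrow>
    (\<forall>D :: 'a \<Rightarrow> 'a cdual. bounded_derivation D \<longrightarrow> inner_derivation D)"


section \<open>The second dual with the first Arens product\<close>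

text \<open>
  A copy of the second dual as a type of its own, so that it can be made an instance of the class
  of Banach algebras.
\<close>

typedef (overloaded) 'a bidual = "UNIV :: 'a::complex_banach_algebra cdual cdual set"
  morphisms of_bidual to_bidual
  by simp

setup_lifting type_definition_bidual

abbreviation bidual_apply :: "'a::complex_banach_algebra bidual \<Rightarrow> 'a cdual \<Rightarrow> complex"
  where "bidual_apply F \<equiv> dual_apply (of_bidual F)"

lemma bidual_eqI: "(\<And>f. bidual_apply F f = bidual_apply G f) \<Longrightarrow> F = G"
  by transfer (rule cdual_eqI)

lemma norm_dual_rmult: "norm (f \<triangleleft> a) \<le> norm f * norm a"
proof (rule norm_cdual_le)
  fix x
  have "cmod (dual_apply f (a * x)) \<le> norm f * norm (a * x)"
    by (rule norm_dual_apply)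
  also have "\<dots> \<le> norm f * (norm a * norm x)"
    by (intro mult_left_mono norm_mult_ineq) simp
  finally show "cmod (dual_apply (f \<triangleleft> a) x) \<le> norm f * norm a * norm x"
    by (simp add: dual_rmult.rep_eq mult.assoc)
qed simp

text \<open>The functional \<open>F f\<close> on the algebra, for \<open>F\<close> in the second dual and \<open>f\<close> in the dual.\<close>

lift_definition arens_action ::
  "'a::complex_banach_algebra bidual \<Rightarrow> 'a cdual \<Rightarrow> 'a cdual"  (infixr \<open>\<odot>\<close> 70)
  is "\<lambda>F f a. dual_apply F (f \<triangleleft> a)"
proof (rule bounded_clinearI)
  fix F :: "'a cdual cdual" and f :: "'a cdual" and x y :: 'a and c :: complex
  have "f \<triangleleft> (x + y) = f \<triangleleft> x + f \<triangleleft> y"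
    by (rule cdual_eqI) (simp add: dual_rmult.rep_eq dual_apply_add distrib_right)
  then show "dual_apply F (f \<triangleleft> (x + y)) = dual_apply F (f \<triangleleft> x) + dual_apply F (f \<triangleleft> y)"
    by (simp add: dual_apply_add)
  have "f \<triangleleft> (c *\<^sub>C x) = c *\<^sub>C (f \<triangleleft> x)"
    by (rule cdual_eqI) (simp add: dual_rmult.rep_eq dual_apply_scaleC scaleC_mult_left)
  then show "dual_apply F (f \<triangleleft> (c *\<^sub>C x)) = c *\<^sub>C dual_apply F (f \<triangleleft> x)"
    by (simp add: dual_apply_scaleC scaleC_complex_def)
  have "cmod (dual_apply F (f \<triangleleft> x)) \<le> norm F * norm (f \<triangleleft> x)"
    by (rule norm_dual_apply)
  also have "\<dots> \<le> norm F * (norm f * norm x)"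
    by (intro mult_left_mono norm_dual_rmult) simp
  finally show "cmod (dual_apply F (f \<triangleleft> x)) \<le> (norm F * norm f) * norm x"
    by (simp add: mult.assoc)
qed

lemma arens_action_add_right: "F \<odot> (f + g) = F \<odot> f + F \<odot> g"
proof (rule cdual_eqI)
  fix x
  have "(f + g) \<triangleleft> x = f \<triangleleft> x + g \<triangleleft> x"
    by (rule cdual_eqI) (simp add: dual_rmult.rep_eq)
  then show "dual_apply (F \<odot> (f + g)) x = dual_apply (F \<odot> f + F \<odot> g) x"
    by (simp add: arens_action.rep_eq dual_apply_add)
qed

lemma arens_action_scaleC_right: "F \<odot> (c *\<^sub>C f) = c *\<^sub>C (F \<odot> f)"
proof (rule cdual_eqI)
  fix x
  have "(c *\<^sub>C f) \<triangleleft> x = c *\<^sub>C (f \<triangleleft> x)"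
    by (rule cdual_eqI) (simp add: dual_rmult.rep_eq)
  then show "dual_apply (F \<odot> (c *\<^sub>C f)) x = dual_apply (c *\<^sub>C (F \<odot> f)) x"
    by (simp add: arens_action.rep_eq dual_apply_scaleC)
qed

lemma norm_arens_action: "norm (F \<odot> f) \<le> norm (of_bidual F) * norm f"
proof (rule norm_cdual_le)
  fix x
  have "cmod (bidual_apply F (f \<triangleleft> x)) \<le> norm (of_bidual F) * norm (f \<triangleleft> x)"
    by (rule norm_dual_apply)
  also have "\<dots> \<le> norm (of_bidual F) * (norm f * norm x)"
    by (intro mult_left_mono norm_dual_rmult) simp
  finally show "cmod (dual_apply (F \<odot> f) x) \<le> norm (of_bidual F) * norm f * norm x"
    by (simp add: arens_action.rep_eq mult.assoc)
qed simp

lemma bounded_clinear_arens_times: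
  "bounded_clinear (\<lambda>f. bidual_apply F (G \<odot> f))"
proof (rule bounded_clinearI)
  fix f
  have "cmod (bidual_apply F (G \<odot> f)) \<le> norm (of_bidual F) * norm (G \<odot> f)"
    by (rule norm_dual_apply)
  also have "\<dots> \<le> norm (of_bidual F) * (norm (of_bidual G) * norm f)"
    by (intro mult_left_mono norm_arens_action) simp
  finally show "cmod (bidual_apply F (G \<odot> f)) \<le> (norm (of_bidual F) * norm (of_bidual G)) * norm f"
    by (simp add: mult.assoc)
qed (simp_all add: arens_action_add_right arens_action_scaleC_right dual_apply_add
      dual_apply_scaleC scaleC_complex_def)

instantiation bidual :: (complex_banach_algebra) complex_normed_vector
begin

lift_definition zero_bidual :: "'a bidual" is 0 .
lift_definition uminus_bidual :: "'a bidual \<Rightarrow> 'a bidual" is uminus .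
lift_definition plus_bidual :: "'a bidual \<Rightarrow> 'a bidual \<Rightarrow> 'a bidual" is "(+)" .
lift_definition minus_bidual :: "'a bidual \<Rightarrow> 'a bidual \<Rightarrow> 'a bidual" is "(-)" .
lift_definition scaleR_bidual :: "real \<Rightarrow> 'a bidual \<Rightarrow> 'a bidual" is scaleR .
lift_definition scaleC_bidual :: "complex \<Rightarrow> 'a bidual \<Rightarrow> 'a bidual" is scaleC .
lift_definition norm_bidual :: "'a bidual \<Rightarrow> real" is norm .

definition dist_bidual :: "'a bidual \<Rightarrow> 'a bidual \<Rightarrow> real"
  where "dist_bidual F G = norm (F - G)"

definition sgn_bidual :: "'a bidual \<Rightarrow> 'a bidual"
  where "sgn_bidual F = inverse (norm F) *\<^sub>R F"

definition uniformity_bidual :: "('a bidual \<times> 'a bidual) filter"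
  where "uniformity_bidual = (INF e\<in>{0<..}. principal {(F, G). dist F G < e})"

definition open_bidual :: "'a bidual set \<Rightarrow> bool"
  where "open_bidual U \<longleftrightarrow> (\<forall>F\<in>U. eventually (\<lambda>(F', G). F' = F \<longrightarrow> G \<in> U) uniformity)"

instance
proof
  fix f g h :: "'a bidual" and r s :: real and c d :: complex
  show "f + g + h = f + (g + h)" "f + g = g + f" "0 + f = f" "- f + f = 0" "f - g = f + - g"
    by (transfer; simp add: algebra_simps)+
  show "r *\<^sub>R (f + g) = r *\<^sub>R f + r *\<^sub>R g" "(r + s) *\<^sub>R f = r *\<^sub>R f + s *\<^sub>R f"
    "r *\<^sub>R s *\<^sub>R f = (r * s) *\<^sub>R f" "1 *\<^sub>R f = f"
    by (transfer; simp add: algebra_simps)+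
  show "c *\<^sub>C (f + g) = c *\<^sub>C f + c *\<^sub>C g" "(c + d) *\<^sub>C f = c *\<^sub>C f + d *\<^sub>C f"
    "c *\<^sub>C d *\<^sub>C f = (c * d) *\<^sub>C f" "complex_of_real r *\<^sub>C f = r *\<^sub>R f"
    by (transfer; simp add: scaleC_add_right scaleC_add_left scaleC_scaleC scaleC_of_real)+
  show "norm (r *\<^sub>R f) = \<bar>r\<bar> * norm f" "norm (c *\<^sub>C f) = cmod c * norm f"
    "(norm f = 0) = (f = 0)"
    by (transfer; simp add: norm_scaleC)+
  show "norm (f + g) \<le> norm f + norm g"
    by transfer (rule norm_triangle_ineq)
qed (rule dist_bidual_def sgn_bidual_def uniformity_bidual_def open_bidual_def)+

end

instantiation bidual :: (complex_banach_algebra) complex_banach_algebra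
begin

text \<open>The first Arens product.\<close>

definition times_bidual :: "'a bidual \<Rightarrow> 'a bidual \<Rightarrow> 'a bidual"
  where "F * G = to_bidual (Abs_cdual (\<lambda>f. bidual_apply F (G \<odot> f)))"

lemma bidual_apply_times: "bidual_apply (F * G) f = bidual_apply F (G \<odot> f)"
  by (simp add: times_bidual_def to_bidual_inverse Abs_cdual_inverse bounded_clinear_arens_times)

lemma arens_action_times: "(F * G) \<odot> f = F \<odot> (G \<odot> f)"
proof (rule cdual_eqI)
  fix x
  have "G \<odot> (f \<triangleleft> x) = (G \<odot> f) \<triangleleft> x"
  proof (rule cdual_eqI)
    fix y
    have "f \<triangleleft> x \<triangleleft> y = f \<triangleleft> (x * y)"
      by (rule cdual_eqI) (simp add: dual_rmult.rep_eq mult.assoc)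
    then show "dual_apply (G \<odot> (f \<triangleleft> x)) y = dual_apply ((G \<odot> f) \<triangleleft> x) y"
      by (simp add: arens_action.rep_eq dual_rmult.rep_eq)
  qed
  then show "dual_apply ((F * G) \<odot> f) x = dual_apply (F \<odot> (G \<odot> f)) x"
    by (simp add: arens_action.rep_eq bidual_apply_times)
qed

instance
proof
  fix F G H :: "'a bidual" and r :: real and c :: complex
  show "F * G * H = F * (G * H)"
    by (rule bidual_eqI) (simp add: bidual_apply_times arens_action_times)
  have add: "(F + G) \<odot> f = F \<odot> f + G \<odot> f" for F G :: "'a bidual" and f
    by (rule cdual_eqI) (simp add: arens_action.rep_eq plus_bidual.rep_eq)
  have scale: "(c *\<^sub>C F) \<odot> f = c *\<^sub>C (F \<odot> f)" for c and F :: "'a bidual" and f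
    by (rule cdual_eqI) (simp add: arens_action.rep_eq scaleC_bidual.rep_eq)
  show "(F + G) * H = F * H + G * H"
    by (rule bidual_eqI) (simp add: bidual_apply_times plus_bidual.rep_eq)
  show "F * (G + H) = F * G + F * H"
    by (rule bidual_eqI) (simp add: bidual_apply_times plus_bidual.rep_eq add dual_apply_add)
  show l: "(c *\<^sub>C F) * G = c *\<^sub>C (F * G)" for c and F G :: "'a bidual"
    by (rule bidual_eqI) (simp add: bidual_apply_times scaleC_bidual.rep_eq)
  show r: "F * (c *\<^sub>C G) = c *\<^sub>C (F * G)" for c and F G :: "'a bidual"
    by (rule bidual_eqI)
      (simp add: bidual_apply_times scaleC_bidual.rep_eq scale dual_apply_scaleC)
  show "(r *\<^sub>R F) * G = r *\<^sub>R (F * G)" "F * (r *\<^sub>R G) = r *\<^sub>R (F * G)"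
    using l[of "complex_of_real r" F G] r[of F "complex_of_real r" G]
    by (simp_all add: scaleC_of_real)
  show "norm (F * G) \<le> norm F * norm G"
    unfolding norm_bidual.rep_eq
  proof (rule norm_cdual_le)
    fix f
    have "cmod (bidual_apply F (G \<odot> f)) \<le> norm (of_bidual F) * norm (G \<odot> f)"
      by (rule norm_dual_apply)
    also have "\<dots> \<le> norm (of_bidual F) * (norm (of_bidual G) * norm f)"
      by (intro mult_left_mono norm_arens_action) simp
    finally show "cmod (bidual_apply (F * G) f)
        \<le> norm (of_bidual F) * norm (of_bidual G) * norm f"
      by (simp add: bidual_apply_times mult.assoc)
  qed simp
next
  fix X :: "nat \<Rightarrow> 'a bidual"
  assume X: "Cauchy X"
  have dist: "dist F G = dist (of_bidual F) (of_bidual G)" for F G :: "'a bidual"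
    by (simp add: dist_norm norm_bidual.rep_eq minus_bidual.rep_eq)
  have "Cauchy (\<lambda>n. of_bidual (X n))"
    using X by (simp add: Cauchy_def dist)
  then obtain L where "(\<lambda>n. of_bidual (X n)) \<longlonglongrightarrow> L"
    using Cauchy_convergent_iff convergent_def by blast
  then have "X \<longlonglongrightarrow> to_bidual L"
    unfolding tendsto_iff by (simp add: dist to_bidual_inverse)
  then show "convergent X"
    by (auto simp: convergent_def)
qed

end

text \<open>The canonical embedding of the dual into the third dual, by evaluation.\<close>

lift_definition dual_embed ::
  "'a::complex_banach_algebra cdual \<Rightarrow> 'a bidual cdual"
  is "\<lambda>f F. bidual_apply F f"
proof (rule bounded_clinearI)
  fix f :: "'a cdual" and F G :: "'a bidual" and c :: complex
  show "bidual_apply (F + G) f = bidual_apply F f + bidual_apply G f"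
    by (simp add: plus_bidual.rep_eq)
  show "bidual_apply (c *\<^sub>C F) f = c *\<^sub>C bidual_apply F f"
    by (simp add: scaleC_bidual.rep_eq scaleC_complex_def)
  show "cmod (bidual_apply F f) \<le> norm f * norm F"
    using norm_dual_apply[of "of_bidual F" f] by (simp add: norm_bidual.rep_eq mult.commute)
qed

end

theory Submission
  imports Defs
begin

text \<open>
  Let \<open>D\<close> be a bounded derivation from \<open>A\<close> to its dual.  Its second transpose \<open>D''\<close> maps the second
  dual of \<open>A\<close> to the third dual and extends \<open>D\<close>.  If \<open>D''\<close> is again a derivation, then it is inner
  by assumption, implemented by some \<open>\<Phi>\<close>, and the restriction of \<open>\<Phi>\<close> to the canonical copy of \<open>A\<close>
  implements \<open>D\<close>.

  That \<open>D''\<close> is a derivation would be seen by taking iterated weak-star limits along nets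
  \<open>a\<^sub>i \<rightarrow> F\<close> and \<open>b\<^sub>j \<rightarrow> G\<close> in \<open>D(a\<^sub>i b\<^sub>j) = a\<^sub>i D(b\<^sub>j) + D(a\<^sub>i) b\<^sub>j\<close>.  The second summand converges to
  \<open>D''(F) G\<close> for any \<open>A\<close>, because this is the order of limits that defines the first Arens product.
  The first one, evaluated at \<open>H\<close>, becomes \<open>\<langle>D''(G) H, a\<^sub>i\<rangle>\<close> after the limit over \<open>j\<close>, and this
  converges to \<open>\<langle>D''(G) H, F\<rangle>\<close> as soon as \<open>D''(G) H\<close> is weak-star continuous, that is, lies in
  the canonical image of the dual of \<open>A\<close>.  The hypothesis on products in the third dual
  ensures this.  Since the Arens product is given by duality, the computation can be done without
  nets: a limit along \<open>a\<^sub>i\<close> is the value of \<open>F\<close> at a functional of \<open>a\<close>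
  (lemmas \<open>transpose_derivation_rmult\<close> and \<open>bounded_derivation_second_transpose\<close>).
\<close>

section \<open>Transposes and the embedding into the second dual\<close>

definition ctranspose ::
    "('a::complex_normed_vector \<Rightarrow> 'b::complex_normed_vector) \<Rightarrow> 'b cdual \<Rightarrow> 'a cdual"
  where "ctranspose L \<phi> = Abs_cdual (\<lambda>x. dual_apply \<phi> (L x))"

lemma ctranspose_apply:
  assumes "bounded_clinear L"
  shows "dual_apply (ctranspose L \<phi>) x = dual_apply \<phi> (L x)"
proof -
  have "bounded_clinear (\<lambda>x. dual_apply \<phi> (L x))"
    using assms bounded_linear_compose[OF bounded_linear_dual_apply[of \<phi>], of L]
    by (simp add: bounded_clinear_def dual_apply_scaleC scaleC_complex_def)
  then show ?thesis
    by (simp add: ctranspose_def Abs_cdual_inverse)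
qed

lemma bounded_clinear_ctranspose:
  assumes L: "bounded_clinear L"
  shows "bounded_clinear (ctranspose L)"
proof -
  obtain K where K: "0 < K" "\<And>x. norm (L x) \<le> norm x * K"
    using bounded_linear.pos_bounded[OF bounded_clinear_bounded_linear[OF L]] by blast
  show ?thesis
  proof (rule bounded_clinearI)
    show "ctranspose L (\<phi> + \<psi>) = ctranspose L \<phi> + ctranspose L \<psi>" for \<phi> \<psi>
      by (rule cdual_eqI) (simp add: ctranspose_apply L)
    show "ctranspose L (c *\<^sub>C \<phi>) = c *\<^sub>C ctranspose L \<phi>" for c \<phi>
      by (rule cdual_eqI) (simp add: ctranspose_apply L)
    show "norm (ctranspose L \<phi>) \<le> K * norm \<phi>" for \<phi>
    proof (rule norm_cdual_le)
      fix x
      have "cmod (dual_apply \<phi> (L x)) \<le> norm \<phi> * norm (L x)"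
        by (rule norm_dual_apply)
      also have "\<dots> \<le> norm \<phi> * (norm x * K)"
        by (intro mult_left_mono K) simp
      finally show "cmod (dual_apply (ctranspose L \<phi>) x) \<le> K * norm \<phi> * norm x"
        by (simp add: ctranspose_apply L mult_ac)
    qed (use K in simp)
  qed
qed

lemma bounded_clinear_compose:
  "bounded_clinear f \<Longrightarrow> bounded_clinear g \<Longrightarrow> bounded_clinear (\<lambda>x. f (g x))"
  by (simp add: bounded_clinear_def bounded_linear_compose)

lemma bounded_clinear_of_bidual: "bounded_clinear of_bidual"
  by (rule bounded_clinearI[where K = 1])
    (simp_all add: plus_bidual.rep_eq scaleC_bidual.rep_eq norm_bidual.rep_eq)

lift_definition bidual_embed :: "'a::complex_banach_algebra \<Rightarrow> 'a bidual"
  is "\<lambda>a. Abs_cdual (\<lambda>f. dual_apply f a)" .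

lemma bidual_embed_apply: "bidual_apply (bidual_embed a) f = dual_apply f a"
proof -
  have "bounded_clinear (\<lambda>f. dual_apply f a)"
    by (rule bounded_clinearI[where K = "norm a"])
      (simp_all add: scaleC_complex_def mult.commute norm_dual_apply
        order.trans[OF norm_dual_apply])
  then show ?thesis
    by (simp add: bidual_embed.rep_eq Abs_cdual_inverse)
qed

lemma bounded_clinear_bidual_embed: "bounded_clinear bidual_embed"
proof (rule bounded_clinearI)
  show "bidual_embed (x + y) = bidual_embed x + bidual_embed y" for x y :: 'a
    by (rule bidual_eqI) (simp add: bidual_embed_apply plus_bidual.rep_eq dual_apply_add)
  show "bidual_embed (c *\<^sub>C x) = c *\<^sub>C bidual_embed x" for c and x :: 'a
    by (rule bidual_eqI) (simp add: bidual_embed_apply scaleC_bidual.rep_eq dual_apply_scaleC)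
  show "norm (bidual_embed x) \<le> 1 * norm x" for x :: 'a
    unfolding norm_bidual.rep_eq
    by (rule norm_cdual_le) (simp_all add: bidual_embed_apply norm_dual_apply mult.commute[of "norm x"])
qed

lemma bidual_apply_times_embed:
  "bidual_apply (H * bidual_embed a) f = bidual_apply H (a \<triangleright> f)"
proof -
  have "bidual_embed a \<odot> f = a \<triangleright> f"
    by (rule cdual_eqI)
      (simp add: arens_action.rep_eq bidual_embed_apply dual_rmult.rep_eq dual_lmult.rep_eq)
  then show ?thesis
    by (simp add: bidual_apply_times)
qed

lemma bidual_embed_mult: "bidual_embed (a * b) = bidual_embed a * bidual_embed b"
  by (rule bidual_eqI)
    (simp add: bidual_apply_times_embed bidual_embed_apply dual_lmult.rep_eq)


section \<open>The second transpose of a derivation\<close>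

definition bitranspose ::
    "('a::complex_banach_algebra \<Rightarrow> 'a cdual) \<Rightarrow> 'a bidual \<Rightarrow> 'a bidual cdual"
  where "bitranspose D F = ctranspose (\<lambda>H. ctranspose D (of_bidual H)) (of_bidual F)"

lemma bounded_clinear_bitranspose:
  assumes "bounded_clinear D"
  shows "bounded_clinear (bitranspose D)"
  unfolding bitranspose_def
  by (intro bounded_clinear_compose[OF bounded_clinear_ctranspose] assms
      bounded_clinear_of_bidual bounded_clinear_ctranspose)

lemma bitranspose_apply:
  assumes "bounded_clinear D"
  shows "dual_apply (bitranspose D F) H = bidual_apply F (ctranspose D (of_bidual H))"
  unfolding bitranspose_def
  by (intro ctranspose_apply bounded_clinear_compose[OF bounded_clinear_ctranspose] assms
      bounded_clinear_of_bidual)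

lemma bitranspose_embed:
  assumes "bounded_clinear D"
  shows "dual_apply (bitranspose D (bidual_embed a)) (bidual_embed b) = dual_apply (D a) b"
  by (simp add: bitranspose_apply bidual_embed_apply ctranspose_apply assms)

text \<open>
  The Leibniz rule in transposed form, obtained by evaluating \<open>H\<close> at \<open>D (a * b)\<close> and reading the
  result as a functional of \<open>b\<close>.
\<close>

lemma transpose_derivation_rmult:
  assumes D: "bounded_derivation D"
  shows "ctranspose D (of_bidual H) \<triangleleft> a =
    ctranspose D (of_bidual (H * bidual_embed a)) + H \<odot> D a"
proof (rule cdual_eqI)
  fix b
  have cl: "bounded_clinear D" and mult: "D (a * b) = a \<triangleright> D b + D a \<triangleleft> b"
    using D by (auto simp: bounded_derivation_def)
  show "dual_apply (ctranspose D (of_bidual H) \<triangleleft> a) b =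
      dual_apply (ctranspose D (of_bidual (H * bidual_embed a)) + H \<odot> D a) b"
    by (simp add: dual_rmult.rep_eq ctranspose_apply[OF cl] mult dual_apply_add
        bidual_apply_times_embed arens_action.rep_eq)
qed

text \<open>
  Applying \<open>G\<close> to the transposed Leibniz rule gives a functional of \<open>a\<close> with two parts.  One is the
  transpose of \<open>D\<close> at \<open>G * H\<close>.  The other is \<open>bitranspose D G \<triangleleft> H\<close> restricted to the canonical copy
  of the algebra; the value of \<open>F\<close> at this restriction is \<open>(bitranspose D G \<triangleleft> H) F\<close> when that
  functional is weak-star continuous, which is what the assumption provides.
\<close>

lemma bounded_derivation_second_transpose:
  fixes D :: "'a::complex_banach_algebra \<Rightarrow> 'a cdual"
  assumes D: "bounded_derivation D"
    and wstar: "\<And>G H. bitranspose D G \<triangleleft> H \<in> range dual_embed"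
  shows "bounded_derivation (bitranspose D)"
  unfolding bounded_derivation_def
proof (intro conjI allI)
  have cl: "bounded_clinear D"
    using D by (simp add: bounded_derivation_def)
  show "bounded_clinear (bitranspose D)"
    by (rule bounded_clinear_bitranspose[OF cl])
  fix F G :: "'a bidual"
  show "bitranspose D (F * G) = F \<triangleright> bitranspose D G + bitranspose D F \<triangleleft> G"
  proof (rule cdual_eqI)
    fix H
    obtain g where g: "bitranspose D G \<triangleleft> H = dual_embed g"
      using wstar by blast
    have "G \<odot> ctranspose D (of_bidual H) = g + ctranspose D (of_bidual (G * H))"
    proof (rule cdual_eqI)
      fix a
      have "dual_apply (G \<odot> ctranspose D (of_bidual H)) a
          = dual_apply (bitranspose D G) (H * bidual_embed a) + bidual_apply G (H \<odot> D a)"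
        by (simp add: arens_action.rep_eq transpose_derivation_rmult[OF D] dual_apply_add
            bitranspose_apply[OF cl])
      also have "dual_apply (bitranspose D G) (H * bidual_embed a)
          = dual_apply (bitranspose D G \<triangleleft> H) (bidual_embed a)"
        by (simp add: dual_rmult.rep_eq)
      also have "\<dots> = dual_apply g a"
        by (simp add: g dual_embed.rep_eq bidual_embed_apply)
      also have "bidual_apply G (H \<odot> D a) = dual_apply (ctranspose D (of_bidual (G * H))) a"
        by (simp add: ctranspose_apply[OF cl] bidual_apply_times)
      finally show "dual_apply (G \<odot> ctranspose D (of_bidual H)) a
          = dual_apply (g + ctranspose D (of_bidual (G * H))) a"
        by simp
    qed
    then have "dual_apply (bitranspose D (F * G)) H
        = bidual_apply F g + dual_apply (bitranspose D F) (G * H)"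
      by (simp add: bitranspose_apply[OF cl] bidual_apply_times dual_apply_add)
    also have "bidual_apply F g = dual_apply (bitranspose D G \<triangleleft> H) F"
      by (simp add: g dual_embed.rep_eq)
    finally show "dual_apply (bitranspose D (F * G)) H
        = dual_apply (F \<triangleright> bitranspose D G + bitranspose D F \<triangleleft> G) H"
      by (simp add: dual_rmult.rep_eq dual_lmult.rep_eq)
  qed
qed

text \<open>
  The canonical embedding is multiplicative, so pulling the implementing functional back along it
  turns the commutator in the third dual into the commutator in the dual.
\<close>

lemma inner_derivation_of_bitranspose:
  fixes D :: "'a::complex_banach_algebra \<Rightarrow> 'a cdual"
  assumes cl: "bounded_clinear D" and "inner_derivation (bitranspose D)"
  shows "inner_derivation D"
proof -
  obtain \<Phi> where \<Phi>: "\<And>F. bitranspose D F = F \<triangleright> \<Phi> - \<Phi> \<triangleleft> F"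
    using assms(2) by (auto simp: inner_derivation_def)
  define f where "f = ctranspose bidual_embed \<Phi>"
  have "D a = a \<triangleright> f - f \<triangleleft> a" for a
  proof (rule cdual_eqI)
    fix b
    have "dual_apply (D a) b = dual_apply (bitranspose D (bidual_embed a)) (bidual_embed b)"
      by (simp add: bitranspose_embed[OF cl])
    also have "\<dots> = dual_apply (a \<triangleright> f - f \<triangleleft> a) b"
      by (simp add: \<Phi> f_def dual_rmult.rep_eq dual_lmult.rep_eq bidual_embed_mult
          ctranspose_apply[OF bounded_clinear_bidual_embed])
    finally show "dual_apply (D a) b = dual_apply (a \<triangleright> f - f \<triangleleft> a) b" .
  qed
  then show ?thesis
    by (auto simp: inner_derivation_def)
qed

theorem mainTheorem9:
  assumes "{\<Phi> \<triangleleft> F | (\<Phi> :: 'a::complex_banach_algebra bidual cdual) (F :: 'a bidual). True}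
             \<subseteq> range dual_embed"
    and "weakly_amenable TYPE('a bidual)"
  shows "weakly_amenable TYPE('a)"
  unfolding weakly_amenable_def
proof (intro allI impI)
  fix D :: "'a \<Rightarrow> 'a cdual"
  assume D: "bounded_derivation D"
  have "bounded_derivation (bitranspose D)"
    by (rule bounded_derivation_second_transpose[OF D]) (use assms(1) in blast)
  then have "inner_derivation (bitranspose D)"
    using assms(2) by (simp add: weakly_amenable_def)
  then show "inner_derivation D"
    using D inner_derivation_of_bitranspose by (auto simp: bounded_derivation_def)
qed

end
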